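(* Let $K$ be a field, let $m,n$ be positive integers, and let $M$ be a thin indecomposable (finite-dimensional) $K$-representation of the equioriented commutative grid $\vec{G}_{m,n}$. Then $M$ is isomorphic to an interval representation.
   Context: $\vec{G}_{m,n}$ is the bound quiver with vertices $(i,j)$, $1\le i\le m$, $1\le j\le n$, arrows $(i,j)\to(i+1,j)$ and $(i,j)\to(i,j+1)$ whenever both ends are vertices, and full commutativity relations (all parallel paths of length $\ge 2$ are identified). A representation assigns a $K$-vector space $V(x)$ to each vertex and a linear map $V(\alpha)$ to each arrow, satisfying the relations. $V$ is indecomposable if $V\cong V_1\oplus V_2$ implies $V_1=0$ or $V_2=0$. $V$ is thin if $\dim_K V(x)\le 1$ for every vertex $x$. The support $\operatorname{supp}(V)$ is the full subquiver on the vertices $x$ with $V(x)\ne 0$. An interval of a quiver $Q$ is a full subquiver $Q'$ that is convex (for all vertices $x,y$ of $Q'$ and all paths in $Q$ from $x$ to $y$, all vertices of the path lie in $Q'$) and connected (as an undirected graph). A representation $V$ is an interval representation if it is thin, $\operatorname{supp}(V)$ is an interval of the quiver, and $V(\alpha)$ is an identity map for every arrow $\alpha$ of $\operatorname{supp}(V)$. *)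

theory Defs
  imports "Graph_Theory.Digraph_Component" "Jordan_Normal_Form.Missing_VectorSpace"
begin

text \<open>
  Quivers are \<^typ>\<open>('x,'a) pre_digraph\<close> and paths are directed arc walks
  \<^const>\<open>pre_digraph.awalk\<close>; the trivial paths are the empty lists. The dimension theory is that
  of \<^locale>\<open>vectorspace\<close>, which takes the field and the space as explicit carrier structures, so
  different vertices may carry unrelated vector spaces.
\<close>

definition grid :: "nat \<Rightarrow> nat \<Rightarrow> (nat \<times> nat, (nat \<times> nat) \<times> (nat \<times> nat)) pre_digraph" where
  "grid m n =
    \<lparr> verts = {1..m} \<times> {1..n},
      arcs = {(x, y). x \<in> {1..m} \<times> {1..n} \<and> y \<in> {1..m} \<times> {1..n} \<and>
                      (y = (Suc (fst x), snd x) \<or> y = (fst x, Suc (snd x)))},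
      tail = fst, head = snd \<rparr>"

lemma wf_digraph_grid: "wf_digraph (grid m n)"
  by unfold_locales (auto simp: grid_def)

record ('x, 'a, 'k, 'v) quiver_rep =
  rep_space :: "'x \<Rightarrow> ('k, 'v) module"
  rep_map :: "'a \<Rightarrow> 'v \<Rightarrow> 'v"

text \<open>
  The value of a representation on a path \<open>p\<close> is \<open>fold (rep_map V) p\<close>, the composite of the maps of
  the arrows of \<open>p\<close> with the first arrow applied first. Only values at the vertices and arrows of
  the quiver, and on the carriers, are meaningful.
\<close>

definition representation ::
  "('k, 'r) ring_scheme \<Rightarrow> ('x, 'a) pre_digraph \<Rightarrow> ('x, 'a, 'k, 'v) quiver_rep \<Rightarrow> bool" where
  "representation K Q V \<longleftrightarrow>
    (\<forall>x \<in> verts Q. vectorspace K (rep_space V x)) \<and>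
    (\<forall>a \<in> arcs Q. linear_map K (rep_space V (tail Q a)) (rep_space V (head Q a)) (rep_map V a))"

definition comm_representation ::
  "('k, 'r) ring_scheme \<Rightarrow> ('x, 'a) pre_digraph \<Rightarrow> ('x, 'a, 'k, 'v) quiver_rep \<Rightarrow> bool" where
  "comm_representation K Q V \<longleftrightarrow>
    representation K Q V \<and>
    (\<forall>x y p q. pre_digraph.awalk Q x p y \<and> pre_digraph.awalk Q x q y \<and> 2 \<le> length p \<and> 2 \<le> length q \<longrightarrow>
      (\<forall>v \<in> carrier (rep_space V x). fold (rep_map V) p v = fold (rep_map V) q v))"

definition rep_iso ::
  "('k, 'r) ring_scheme \<Rightarrow> ('x, 'a) pre_digraph \<Rightarrow> ('x, 'a, 'k, 'v) quiver_rep \<Rightarrow>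
    ('x, 'a, 'k, 'w) quiver_rep \<Rightarrow> bool" where
  "rep_iso K Q V W \<longleftrightarrow>
    (\<exists>f. (\<forall>x \<in> verts Q. linear_map K (rep_space V x) (rep_space W x) (f x) \<and>
                        bij_betw (f x) (carrier (rep_space V x)) (carrier (rep_space W x))) \<and>
         (\<forall>a \<in> arcs Q. \<forall>v \<in> carrier (rep_space V (tail Q a)).
            f (head Q a) (rep_map V a v) = rep_map W a (f (tail Q a) v)))"

definition rep_sum ::
  "('x, 'a, 'k, 'v) quiver_rep \<Rightarrow> ('x, 'a, 'k, 'w) quiver_rep \<Rightarrow> ('x, 'a, 'k, 'v \<times> 'w) quiver_rep" where
  "rep_sum V W =
    \<lparr> rep_space = (\<lambda>x. direct_sum (rep_space V x) (rep_space W x)),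
      rep_map = (\<lambda>a. map_prod (rep_map V a) (rep_map W a)) \<rparr>"

definition zero_rep :: "('x, 'a) pre_digraph \<Rightarrow> ('x, 'a, 'k, 'v) quiver_rep \<Rightarrow> bool" where
  "zero_rep Q V \<longleftrightarrow> (\<forall>x \<in> verts Q. carrier (rep_space V x) = {\<zero>\<^bsub>rep_space V x\<^esub>})"

text \<open>
  The summands range over representations with elements of the same type as those of \<open>V\<close>. This loses
  nothing: a direct summand of \<open>V\<close> is isomorphic to a subrepresentation of \<open>V\<close>. The zero
  representation is not excluded, and accordingly the empty subquiver is allowed in \<open>interval\<close>
  (the library's \<open>connected\<close> requires a vertex). A nonzero representation has nonempty support, so
  for nonzero representations these are the notions with zero and empty excluded.
\<close>

definition indecomposable ::
  "('k, 'r) ring_scheme \<Rightarrow> ('x, 'a) pre_digraph \<Rightarrow> ('x, 'a, 'k, 'v) quiver_rep \<Rightarrow> bool" where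
  "indecomposable K Q V \<longleftrightarrow>
    (\<forall>(V1 :: ('x, 'a, 'k, 'v) quiver_rep) (V2 :: ('x, 'a, 'k, 'v) quiver_rep).
      comm_representation K Q V1 \<and> comm_representation K Q V2 \<and> rep_iso K Q V (rep_sum V1 V2) \<longrightarrow>
      zero_rep Q V1 \<or> zero_rep Q V2)"

definition fin_dim_rep ::
  "('k, 'r) ring_scheme \<Rightarrow> ('x, 'a) pre_digraph \<Rightarrow> ('x, 'a, 'k, 'v) quiver_rep \<Rightarrow> bool" where
  "fin_dim_rep K Q V \<longleftrightarrow> (\<forall>x \<in> verts Q. vectorspace.fin_dim K (rep_space V x))"

text \<open>
  \<open>vectorspace.dim\<close> is unspecified on infinite-dimensional spaces, hence the first conjunct.
\<close>

definition thin ::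
  "('k, 'r) ring_scheme \<Rightarrow> ('x, 'a) pre_digraph \<Rightarrow> ('x, 'a, 'k, 'v) quiver_rep \<Rightarrow> bool" where
  "thin K Q V \<longleftrightarrow> fin_dim_rep K Q V \<and> (\<forall>x \<in> verts Q. vectorspace.dim K (rep_space V x) \<le> 1)"

definition rep_supp ::
  "('x, 'a) pre_digraph \<Rightarrow> ('x, 'a, 'k, 'v) quiver_rep \<Rightarrow> ('x, 'a) pre_digraph" where
  "rep_supp Q V = Q \<restriction> {x \<in> verts Q. carrier (rep_space V x) \<noteq> {\<zero>\<^bsub>rep_space V x\<^esub>}}"

definition interval :: "('x, 'a) pre_digraph \<Rightarrow> ('x, 'a) pre_digraph \<Rightarrow> bool" where
  "interval Q S \<longleftrightarrow>
    induced_subgraph S Q \<and>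
    (\<forall>x \<in> verts S. \<forall>y \<in> verts S. \<forall>p. pre_digraph.awalk Q x p y \<longrightarrow>
      set (pre_digraph.awalk_verts Q x p) \<subseteq> verts S) \<and>
    (verts S \<noteq> {} \<longrightarrow> Digraph_Component.connected S)"

text \<open>
  For the map of an arrow to be an identity map, the spaces at its two ends have to be the same
  vector space, not merely isomorphic ones.
\<close>

definition interval_rep ::
  "('k, 'r) ring_scheme \<Rightarrow> ('x, 'a) pre_digraph \<Rightarrow> ('x, 'a, 'k, 'v) quiver_rep \<Rightarrow> bool" where
  "interval_rep K Q V \<longleftrightarrow>
    comm_representation K Q V \<and> thin K Q V \<and> interval Q (rep_supp Q V) \<and>
    (\<forall>a \<in> arcs (rep_supp Q V).
      rep_space V (tail Q a) = rep_space V (head Q a) \<and>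
      (\<forall>v \<in> carrier (rep_space V (tail Q a)). rep_map V a v = v))"

end

theory Submission
  imports Defs
begin

text \<open>
  Fix a thin representation \<open>M\<close> of the grid. A nonzero vector \<open>v \<in> M(x)\<close> is carried along an arrow
  \<open>x \<rightarrow> y\<close> to \<open>M(x \<rightarrow> y) v\<close> whenever that is nonzero, and since all spaces are at most lines, carrying
  vectors forward and backward generates an equivalence relation on pairs \<open>(x, v)\<close>. What could keep
  \<open>M\<close> from being an interval representation is monodromy (one class meeting \<open>M(x)\<close> in two vectors)
  or two vertices \<open>x \<le> y\<close> in one class whose structure map \<open>M(x) \<rightarrow> M(y)\<close> is zero.

  The coherence lemma \<open>chain_coherent\<close> excludes both: if \<open>(x, v)\<close> and \<open>(y, w)\<close> are joined by a zigzag
  of such steps and \<open>x \<le> y\<close>, then the structure map sends \<open>v\<close> to \<open>w\<close>. By induction on the length of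
  the zigzag, one may cut it at any intermediate vertex \<open>z\<close> with \<open>z \<le> x\<close>, \<open>y \<le> z\<close> or
  \<open>x \<le> z \<le> y\<close>, because functoriality of the structure maps glues the two halves. Here planarity
  enters: a zigzag of at least two steps with no such vertex inside exists only if \<open>x\<close> and \<open>y\<close> lie on a common grid
  line, and then it leaves \<open>x\<close> to one side of that line and arrives at \<open>y\<close> from the other. It has to
  cross the line in between, and every point of the line is comparable to \<open>x\<close> and \<open>y\<close> in one of the
  three ways.

  The rest is formal. The vertices met by one class split off as a direct summand, so by
  indecomposability they make up the whole support (\<open>reached_eq_supp\<close>). Coherence with \<open>x = y\<close> says that
  the class picks exactly one basis vector at each vertex of the support, and in general that
  structure maps respect these basis vectors. Hence the support is convex, as a nonzero structure map
  does not factor through zero, and it is connected by zigzags (\<open>interval_supp\<close>). Replacing all lines of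
  the support by a single one along the chosen basis turns every arrow into an identity
  (\<open>compatible_basis_imp_interval_rep\<close>).
\<close>

section \<open>Lines and zero spaces\<close>

lemma linear_mapI:
  assumes "vectorspace K V" "vectorspace K W"
    and "\<And>v. v \<in> carrier V \<Longrightarrow> f v \<in> carrier W"
    and "\<And>v w. v \<in> carrier V \<Longrightarrow> w \<in> carrier V \<Longrightarrow> f (v \<oplus>\<^bsub>V\<^esub> w) = f v \<oplus>\<^bsub>W\<^esub> f w"
    and "\<And>c v. c \<in> carrier K \<Longrightarrow> v \<in> carrier V \<Longrightarrow> f (c \<odot>\<^bsub>V\<^esub> v) = c \<odot>\<^bsub>W\<^esub> f v"
  shows "linear_map K V W f"
  using assms
  by (simp add: linear_map_def mod_hom_def mod_hom_axioms_def module_hom_def vectorspace_def)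

lemma linear_mapD:
  assumes "linear_map K V W f"
  shows "vectorspace K V" and "vectorspace K W"
    and "v \<in> carrier V \<Longrightarrow> f v \<in> carrier W"
    and "v \<in> carrier V \<Longrightarrow> w \<in> carrier V \<Longrightarrow> f (v \<oplus>\<^bsub>V\<^esub> w) = f v \<oplus>\<^bsub>W\<^esub> f w"
    and "c \<in> carrier K \<Longrightarrow> v \<in> carrier V \<Longrightarrow> f (c \<odot>\<^bsub>V\<^esub> v) = c \<odot>\<^bsub>W\<^esub> f v"
    and "f \<zero>\<^bsub>V\<^esub> = \<zero>\<^bsub>W\<^esub>"
proof -
  interpret linear_map K V W f by (fact assms)
  show "vectorspace K V" "vectorspace K W" by unfold_locales
  show "v \<in> carrier V \<Longrightarrow> f v \<in> carrier W" by (rule T_im)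
  show "v \<in> carrier V \<Longrightarrow> w \<in> carrier V \<Longrightarrow> f (v \<oplus>\<^bsub>V\<^esub> w) = f v \<oplus>\<^bsub>W\<^esub> f w" by simp
  show "c \<in> carrier K \<Longrightarrow> v \<in> carrier V \<Longrightarrow> f (c \<odot>\<^bsub>V\<^esub> v) = c \<odot>\<^bsub>W\<^esub> f v" by simp
  show "f \<zero>\<^bsub>V\<^esub> = \<zero>\<^bsub>W\<^esub>" by simp
qed

lemma vectorspace_zero:
  assumes "vectorspace K V"
  shows "\<zero>\<^bsub>V\<^esub> \<in> carrier V" and "\<zero>\<^bsub>V\<^esub> \<oplus>\<^bsub>V\<^esub> \<zero>\<^bsub>V\<^esub> = \<zero>\<^bsub>V\<^esub>"
    and "c \<in> carrier K \<Longrightarrow> c \<odot>\<^bsub>V\<^esub> \<zero>\<^bsub>V\<^esub> = \<zero>\<^bsub>V\<^esub>"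
proof -
  interpret vectorspace K V by (fact assms)
  show "\<zero>\<^bsub>V\<^esub> \<in> carrier V" and "\<zero>\<^bsub>V\<^esub> \<oplus>\<^bsub>V\<^esub> \<zero>\<^bsub>V\<^esub> = \<zero>\<^bsub>V\<^esub>"
    and "c \<in> carrier K \<Longrightarrow> c \<odot>\<^bsub>V\<^esub> \<zero>\<^bsub>V\<^esub> = \<zero>\<^bsub>V\<^esub>"
    by simp_all
qed

context vectorspace
begin

lemma singleton_lin_indpt:
  assumes "e \<in> carrier V" and "e \<noteq> \<zero>\<^bsub>V\<^esub>"
  shows "lin_indpt {e}"
proof -
  have "lin_indpt {}"
    unfolding lin_dep_def by auto
  moreover have "e \<notin> span {}"
    using assms by (simp add: span_empty)
  ultimately show ?thesis
    using lin_dep_iff_in_span[of "{}" e] assms by auto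
qed

lemma line_spanned:
  assumes "fin_dim" and "dim \<le> 1"
    and e: "e \<in> carrier V" "e \<noteq> \<zero>\<^bsub>V\<^esub>" and "v \<in> carrier V"
  obtains c where "c \<in> carrier K" and "v = c \<odot>\<^bsub>V\<^esub> e"
proof -
  have "basis {e}"
    using assms singleton_lin_indpt[OF e] by (intro dim_li_is_basis) auto
  then have "v \<in> span {e}"
    using assms by (simp add: basis_def)
  then obtain a where "a \<in> {e} \<rightarrow> carrier K" "lincomb a {e} = v"
    using finite_in_span[of "{e}" v] e by auto
  then show ?thesis
    using e by (intro that[of "a e"]) (auto simp: lincomb_def)
qed

lemma scale_inject:
  assumes "c \<in> carrier K" "d \<in> carrier K" and e: "e \<in> carrier V" "e \<noteq> \<zero>\<^bsub>V\<^esub>"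
    and eq: "c \<odot>\<^bsub>V\<^esub> e = d \<odot>\<^bsub>V\<^esub> e"
  shows "c = d"
proof (rule ccontr)
  assume "c \<noteq> d"
  define z where "z = c \<ominus>\<^bsub>K\<^esub> d"
  have z: "z \<in> carrier K" "z \<noteq> \<zero>\<^bsub>K\<^esub>"
    using \<open>c \<noteq> d\<close> assms by (auto simp: z_def)
  have "z \<odot>\<^bsub>V\<^esub> e = c \<odot>\<^bsub>V\<^esub> e \<oplus>\<^bsub>V\<^esub> \<ominus>\<^bsub>V\<^esub> (d \<odot>\<^bsub>V\<^esub> e)"
    using assms by (simp add: z_def a_minus_def smult_l_distr smult_l_minus)
  also have "\<dots> = \<zero>\<^bsub>V\<^esub>"
    using assms by (simp add: M.r_neg)
  finally have "e = inv\<^bsub>K\<^esub> z \<odot>\<^bsub>V\<^esub> \<zero>\<^bsub>V\<^esub>"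
    using mult_inverse z e by blast
  then show False
    using z e field_Units by auto
qed

lemma zero_subspace: "vectorspace K (V\<lparr>carrier := {\<zero>\<^bsub>V\<^esub>}\<rparr>)"
proof (rule subspace_is_vs)
  show "subspace K {\<zero>\<^bsub>V\<^esub>} V"
    unfolding subspace_def submodule_def
    using vectorspace_axioms module_axioms by auto
qed

end

lemma zero_space_dim:
  assumes "vectorspace K V" and "carrier V = {\<zero>\<^bsub>V\<^esub>}"
  shows "vectorspace.fin_dim K V" and "vectorspace.dim K V = 0"
proof -
  interpret vectorspace K V by (fact assms)
  have "gen_set {}"
    using assms by (simp add: span_empty)
  then show "fin_dim"
    unfolding fin_dim_def by auto
  show "dim = 0"
    using \<open>gen_set {}\<close> gen_ge_dim[of "{}"] by simp
qed

lemma line_iso: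
  assumes V: "vectorspace K V" "vectorspace.fin_dim K V" "vectorspace.dim K V \<le> 1"
    and W: "vectorspace K W" "vectorspace.fin_dim K W" "vectorspace.dim K W \<le> 1"
    and e: "e \<in> carrier V" "e \<noteq> \<zero>\<^bsub>V\<^esub>" and e': "e' \<in> carrier W" "e' \<noteq> \<zero>\<^bsub>W\<^esub>"
  obtains f where "linear_map K V W f" and "bij_betw f (carrier V) (carrier W)" and "f e = e'"
proof -
  interpret V: vectorspace K V by (fact V)
  interpret W: vectorspace K W by (fact W)
  define f where "f v = (THE c. c \<in> carrier K \<and> v = c \<odot>\<^bsub>V\<^esub> e) \<odot>\<^bsub>W\<^esub> e'" for v
  have f: "f (c \<odot>\<^bsub>V\<^esub> e) = c \<odot>\<^bsub>W\<^esub> e'" if "c \<in> carrier K" for c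
  proof -
    have "(THE d. d \<in> carrier K \<and> c \<odot>\<^bsub>V\<^esub> e = d \<odot>\<^bsub>V\<^esub> e) = c"
      using that e V.scale_inject[OF _ _ e] by (intro the_equality) auto
    then show ?thesis
      by (simp add: f_def)
  qed
  note V_ex = V.line_spanned[OF V(2,3) e] and W_ex = W.line_spanned[OF W(2,3) e']
  have "linear_map K V W f"
  proof (rule linear_mapI[OF V(1) W(1)])
    fix v assume v: "v \<in> carrier V"
    then obtain c where c: "c \<in> carrier K" "v = c \<odot>\<^bsub>V\<^esub> e" using V_ex by blast
    then show "f v \<in> carrier W" using f e' by simp
    fix d assume "d \<in> carrier K"
    then show "f (d \<odot>\<^bsub>V\<^esub> v) = d \<odot>\<^bsub>W\<^esub> f v"
      using c f e e' by (simp flip: V.smult_assoc1 W.smult_assoc1)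
  next
    fix v w assume "v \<in> carrier V" "w \<in> carrier V"
    then obtain c d where cd: "c \<in> carrier K" "v = c \<odot>\<^bsub>V\<^esub> e" "d \<in> carrier K" "w = d \<odot>\<^bsub>V\<^esub> e"
      using V_ex by metis
    then show "f (v \<oplus>\<^bsub>V\<^esub> w) = f v \<oplus>\<^bsub>W\<^esub> f w"
      using f e e' by (simp flip: V.smult_l_distr W.smult_l_distr)
  qed
  moreover have "bij_betw f (carrier V) (carrier W)"
  proof (rule bij_betw_imageI)
    show "inj_on f (carrier V)"
    proof (rule inj_onI)
      fix v w assume "v \<in> carrier V" "w \<in> carrier V" and eq: "f v = f w"
      then obtain c d where cd: "c \<in> carrier K" "v = c \<odot>\<^bsub>V\<^esub> e" "d \<in> carrier K" "w = d \<odot>\<^bsub>V\<^esub> e"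
        using V_ex by metis
      then have "c = d"
        using eq f W.scale_inject[OF _ _ e'] by simp
      then show "v = w" using cd by simp
    qed
    show "f ` carrier V = carrier W"
    proof
      show "f ` carrier V \<subseteq> carrier W"
        using linear_mapD(3)[OF \<open>linear_map K V W f\<close>] by blast
      show "carrier W \<subseteq> f ` carrier V"
      proof
        fix w assume "w \<in> carrier W"
        then obtain c where "c \<in> carrier K" "w = c \<odot>\<^bsub>W\<^esub> e'" using W_ex by blast
        then show "w \<in> f ` carrier V" using f e by (metis V.smult_closed imageI)
      qed
    qed
  qed
  moreover have "f e = e'"
    using f[of "\<one>\<^bsub>K\<^esub>"] e e' by simp
  ultimately show thesis by (rule that)
qed

section \<open>Maps along paths\<close>

lemma representationD:
  assumes "representation K Q V"
  shows "x \<in> verts Q \<Longrightarrow> vectorspace K (rep_space V x)"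
    and "a \<in> arcs Q \<Longrightarrow> linear_map K (rep_space V (tail Q a)) (rep_space V (head Q a)) (rep_map V a)"
  using assms by (auto simp: representation_def)

lemma comm_representationD:
  assumes "comm_representation K Q V"
  shows "representation K Q V"
    and "\<lbrakk>pre_digraph.awalk Q x p y; pre_digraph.awalk Q x q y; 2 \<le> length p; 2 \<le> length q;
          v \<in> carrier (rep_space V x)\<rbrakk> \<Longrightarrow> fold (rep_map V) p v = fold (rep_map V) q v"
  using assms unfolding comm_representation_def by blast+

lemma fold_path_closed:
  assumes "wf_digraph Q" and "representation K Q V" and "pre_digraph.awalk Q x p y"
    and "v \<in> carrier (rep_space V x)"
  shows "fold (rep_map V) p v \<in> carrier (rep_space V y)"
proof -
  interpret wf_digraph Q by (fact assms)
  show ?thesis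
    using assms(3,4)
  proof (induction p arbitrary: x v)
    case (Cons a p)
    then show ?case
      using linear_mapD(3)[OF representationD(2)[OF assms(2)], of a v] by (auto simp: awalk_Cons_iff)
  qed (auto simp: awalk_Nil_iff)
qed

lemma fold_path_smult:
  assumes "wf_digraph Q" and "representation K Q V" and "pre_digraph.awalk Q x p y"
    and "v \<in> carrier (rep_space V x)" and "c \<in> carrier K"
  shows "fold (rep_map V) p (c \<odot>\<^bsub>rep_space V x\<^esub> v) = c \<odot>\<^bsub>rep_space V y\<^esub> fold (rep_map V) p v"
proof -
  interpret wf_digraph Q by (fact assms)
  show ?thesis
    using assms(3,4)
  proof (induction p arbitrary: x v)
    case (Cons a p)
    then show ?case
      using linear_mapD(3,5)[OF representationD(2)[OF assms(2)], of a] assms(5)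
      by (auto simp: awalk_Cons_iff)
  qed (auto simp: awalk_Nil_iff)
qed

text \<open>
  Commutativity of the representation by identity maps need not be checked on paths: it is carried
  over by an isomorphism, whose components are onto.
\<close>
lemma comm_representation_iso:
  assumes "wf_digraph Q" and V: "comm_representation K Q V" and W: "representation K Q W"
    and iso: "rep_iso K Q V W"
  shows "comm_representation K Q W"
proof -
  interpret wf_digraph Q by (fact assms)
  obtain f where
    bij: "\<And>x. x \<in> verts Q \<Longrightarrow> bij_betw (f x) (carrier (rep_space V x)) (carrier (rep_space W x))"
    and nat: "\<And>a v. a \<in> arcs Q \<Longrightarrow> v \<in> carrier (rep_space V (tail Q a)) \<Longrightarrow>
            f (head Q a) (rep_map V a v) = rep_map W a (f (tail Q a) v)"
    using iso unfolding rep_iso_def by blast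
  have path: "f y (fold (rep_map V) p v) = fold (rep_map W) p (f x v)"
    if "awalk x p y" "v \<in> carrier (rep_space V x)" for x y p v
    using that
  proof (induction p arbitrary: x v)
    case (Cons a p)
    then show ?case
      using linear_mapD(3)[OF representationD(2)[OF comm_representationD(1)[OF V]], of a v] nat[of a v]
      by (auto simp: awalk_Cons_iff)
  qed (auto simp: awalk_Nil_iff)
  show ?thesis
    unfolding comm_representation_def
  proof (intro conjI allI impI ballI)
    show "representation K Q W" by (fact W)
    fix x y p q w
    assume *: "awalk x p y \<and> awalk x q y \<and> 2 \<le> length p \<and> 2 \<le> length q"
      and "w \<in> carrier (rep_space W x)"
    then obtain v where v: "v \<in> carrier (rep_space V x)" "w = f x v"
      using bij[of x] by (auto simp: bij_betw_def)
    then have "fold (rep_map V) p v = fold (rep_map V) q v"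
      using comm_representationD(2)[OF V] * by blast
    then show "fold (rep_map W) p w = fold (rep_map W) q w"
      using path * v by metis
  qed
qed

section \<open>Splitting off a part of the support\<close>

text \<open>
  The spaces outside \<open>D\<close> are cut down to zero while the maps are kept as functions. Hence path values
  are unchanged, and commutativity is inherited, as soon as the restricted maps have the right
  codomains.
\<close>
definition restrict_rep ::
  "'x set \<Rightarrow> ('x, 'a, 'k, 'v) quiver_rep \<Rightarrow> ('x, 'a, 'k, 'v) quiver_rep" where
  "restrict_rep D V =
    \<lparr> rep_space = (\<lambda>x. if x \<in> D then rep_space V x
                       else (rep_space V x)\<lparr>carrier := {\<zero>\<^bsub>rep_space V x\<^esub>}\<rparr>),
      rep_map = rep_map V \<rparr>"

lemma restrict_rep_comm:
  assumes "wf_digraph Q" and V: "comm_representation K Q V"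
    and out: "\<And>a v. \<lbrakk>a \<in> arcs Q; tail Q a \<in> D; head Q a \<notin> D; v \<in> carrier (rep_space V (tail Q a))\<rbrakk>
              \<Longrightarrow> rep_map V a v = \<zero>\<^bsub>rep_space V (head Q a)\<^esub>"
  shows "comm_representation K Q (restrict_rep D V)"
proof -
  interpret wf_digraph Q by (fact assms)
  note R = comm_representationD(1)[OF V]
  have vs: "vectorspace K (rep_space (restrict_rep D V) x)" if "x \<in> verts Q" for x
    using representationD(1)[OF R that] vectorspace.zero_subspace[of K "rep_space V x"]
    by (simp add: restrict_rep_def)
  have lin: "linear_map K (rep_space (restrict_rep D V) (tail Q a))
              (rep_space (restrict_rep D V) (head Q a)) (rep_map (restrict_rep D V) a)"
    if a: "a \<in> arcs Q" for a
    using linear_mapD[OF representationD(2)[OF R a]] out[OF a]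
      vectorspace_zero[OF representationD(1)[OF R, of "tail Q a"]]
      vectorspace_zero[OF representationD(1)[OF R, of "head Q a"]] a
    by (intro linear_mapI vs) (auto simp: restrict_rep_def split: if_splits)
  show ?thesis
    unfolding comm_representation_def
  proof (intro conjI allI impI ballI)
    show "representation K Q (restrict_rep D V)"
      using vs lin by (simp add: representation_def)
    fix x y p q v
    assume *: "awalk x p y \<and> awalk x q y \<and> 2 \<le> length p \<and> 2 \<le> length q"
      and v: "v \<in> carrier (rep_space (restrict_rep D V) x)"
    then have "v \<in> carrier (rep_space V x)"
      using vectorspace_zero(1)[OF representationD(1)[OF R, of x]]
      by (auto simp: restrict_rep_def split: if_splits)
    moreover have "rep_map (restrict_rep D V) = rep_map V"
      by (simp add: restrict_rep_def)
    ultimately show "fold (rep_map (restrict_rep D V)) p v = fold (rep_map (restrict_rep D V)) q v"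
      using comm_representationD(2)[OF V, of x p y q v] * by simp
  qed
qed

text \<open>
  If all arrows between \<open>D\<close> and its complement vanish, then \<open>V\<close> is the direct sum of its restrictions
  to the two parts, so one of them is zero.
\<close>
lemma indecomposable_no_split:
  assumes "wf_digraph Q" and V: "comm_representation K Q V" and indec: "indecomposable K Q V"
    and cut: "\<And>a v. \<lbrakk>a \<in> arcs Q; (tail Q a \<in> D) \<noteq> (head Q a \<in> D); v \<in> carrier (rep_space V (tail Q a))\<rbrakk>
              \<Longrightarrow> rep_map V a v = \<zero>\<^bsub>rep_space V (head Q a)\<^esub>"
  shows "(\<forall>x \<in> verts Q \<inter> D. carrier (rep_space V x) = {\<zero>\<^bsub>rep_space V x\<^esub>}) \<or>
         (\<forall>x \<in> verts Q - D. carrier (rep_space V x) = {\<zero>\<^bsub>rep_space V x\<^esub>})"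
proof -
  interpret wf_digraph Q by (fact assms)
  note R = comm_representationD(1)[OF V]
  let ?V1 = "restrict_rep D V" and ?V2 = "restrict_rep (- D) V"
  have V1: "comm_representation K Q ?V1" and V2: "comm_representation K Q ?V2"
    using cut by (auto intro!: restrict_rep_comm[OF assms(1) V])
  define f where
    "f x v = (if x \<in> D then (v, \<zero>\<^bsub>rep_space V x\<^esub>) else (\<zero>\<^bsub>rep_space V x\<^esub>, v))" for x v
  have lin: "linear_map K (rep_space V x) (rep_space (rep_sum ?V1 ?V2) x) (f x)"
    and bij: "bij_betw (f x) (carrier (rep_space V x)) (carrier (rep_space (rep_sum ?V1 ?V2) x))"
    if x: "x \<in> verts Q" for x
  proof -
    note z = vectorspace_zero[OF representationD(1)[OF R x]]
    have "vectorspace K (rep_space (rep_sum ?V1 ?V2) x)"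
      using representationD(1)[OF comm_representationD(1)[OF V1] x]
        representationD(1)[OF comm_representationD(1)[OF V2] x]
      by (simp add: rep_sum_def direct_sum_is_vs)
    then show "linear_map K (rep_space V x) (rep_space (rep_sum ?V1 ?V2) x) (f x)"
      using z by (intro linear_mapI representationD(1)[OF R x])
        (auto simp: f_def rep_sum_def direct_sum_def restrict_rep_def)
    show "bij_betw (f x) (carrier (rep_space V x)) (carrier (rep_space (rep_sum ?V1 ?V2) x))"
      using z by (intro bij_betw_imageI inj_onI)
        (auto simp: f_def rep_sum_def direct_sum_def restrict_rep_def image_iff split: if_splits)
  qed
  have "f (head Q a) (rep_map V a v) = rep_map (rep_sum ?V1 ?V2) a (f (tail Q a) v)"
    if a: "a \<in> arcs Q" and v: "v \<in> carrier (rep_space V (tail Q a))" for a v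
    using linear_mapD(6)[OF representationD(2)[OF R a]] cut[OF a _ v]
    by (auto simp: f_def rep_sum_def restrict_rep_def)
  then have "rep_iso K Q V (rep_sum ?V1 ?V2)"
    unfolding rep_iso_def using lin bij by blast
  then have "zero_rep Q ?V1 \<or> zero_rep Q ?V2"
    using indec V1 V2 unfolding indecomposable_def by blast
  then show ?thesis
    by (fastforce simp: zero_rep_def restrict_rep_def)
qed

section \<open>Compatible bases give interval representations\<close>

definition supp_verts :: "('x, 'a) pre_digraph \<Rightarrow> ('x, 'a, 'k, 'v) quiver_rep \<Rightarrow> 'x set" where
  "supp_verts Q V = {x \<in> verts Q. carrier (rep_space V x) \<noteq> {\<zero>\<^bsub>rep_space V x\<^esub>}}"

lemma rep_supp_conv: "rep_supp Q V = Q \<restriction> supp_verts Q V"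
  by (simp add: rep_supp_def supp_verts_def)

text \<open>
  All lines of the support are identified with the line at one support vertex \<open>b\<close> by matching the
  chosen basis vectors. Compatibility of these vectors makes the arrows of the support identities
  after this identification; all other arrows start or end in a zero space.
\<close>
lemma compatible_basis_imp_interval_rep:
  fixes V :: "('x, 'a, 'k, 'v) quiver_rep"
  assumes wf: "wf_digraph Q" and V: "comm_representation K Q V" and thin: "thin K Q V"
    and int: "interval Q (rep_supp Q V)"
    and e: "\<And>x. x \<in> supp_verts Q V \<Longrightarrow> e x \<in> carrier (rep_space V x) \<and> e x \<noteq> \<zero>\<^bsub>rep_space V x\<^esub>"
    and compat: "\<And>a. \<lbrakk>a \<in> arcs Q; tail Q a \<in> supp_verts Q V; head Q a \<in> supp_verts Q V\<rbrakk>
                 \<Longrightarrow> rep_map V a (e (tail Q a)) = e (head Q a)"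
    and b: "b \<in> supp_verts Q V"
  obtains I :: "('x, 'a, 'k, 'v) quiver_rep" where "interval_rep K Q I" and "rep_iso K Q V I"
proof -
  interpret wf_digraph Q by (fact wf)
  note R = comm_representationD(1)[OF V]
  define S where "S = supp_verts Q V"
  define B where "B = rep_space V b"
  define I :: "('x, 'a, 'k, 'v) quiver_rep" where
    "I = \<lparr> rep_space = (\<lambda>x. if x \<in> S then B else B\<lparr>carrier := {\<zero>\<^bsub>B\<^esub>}\<rparr>),
           rep_map = (\<lambda>a v. if tail Q a \<in> S \<and> head Q a \<in> S then v else \<zero>\<^bsub>B\<^esub>) \<rparr>"
  have "b \<in> verts Q" using b by (simp add: supp_verts_def)
  have B: "vectorspace K B" "vectorspace.fin_dim K B" "vectorspace.dim K B \<le> 1"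
    using \<open>b \<in> verts Q\<close> representationD(1)[OF R] thin
    by (auto simp: B_def thin_def fin_dim_rep_def)
  note zB = vectorspace_zero[OF B(1)]
  have eb: "e b \<in> carrier B" "e b \<noteq> \<zero>\<^bsub>B\<^esub>"
    using e[OF b] by (auto simp: B_def)
  have Z: "vectorspace K (B\<lparr>carrier := {\<zero>\<^bsub>B\<^esub>}\<rparr>)"
    using B(1) by (rule vectorspace.zero_subspace)
  have I_space: "vectorspace K (rep_space I x)" "vectorspace.fin_dim K (rep_space I x)"
    "vectorspace.dim K (rep_space I x) \<le> 1" for x
    using B Z zero_space_dim[OF Z] by (auto simp: I_def)
  have "representation K Q I"
    unfolding representation_def
  proof (intro conjI ballI)
    fix a assume "a \<in> arcs Q"
    show "linear_map K (rep_space I (tail Q a)) (rep_space I (head Q a)) (rep_map I a)"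
      using zB by (intro linear_mapI I_space) (auto simp: I_def)
  qed (rule I_space)
  have supp_I: "supp_verts Q I = S"
    using eb by (auto simp: supp_verts_def I_def S_def)

  have "\<exists>g. linear_map K (rep_space V x) (rep_space I x) g \<and>
        bij_betw g (carrier (rep_space V x)) (carrier (rep_space I x)) \<and> (x \<in> S \<longrightarrow> g (e x) = e b)"
    if x: "x \<in> verts Q" for x
  proof (cases "x \<in> S")
    case True
    have "rep_space I x = B" using True by (simp add: I_def)
    moreover have "vectorspace.fin_dim K (rep_space V x)" "vectorspace.dim K (rep_space V x) \<le> 1"
      using thin x by (auto simp: thin_def fin_dim_rep_def)
    ultimately show ?thesis
      using line_iso[OF representationD(1)[OF R x] _ _ B, of "e x" "e b"] e[of x] eb True
      unfolding S_def by metis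
  next
    case False
    then have "carrier (rep_space V x) = {\<zero>\<^bsub>rep_space V x\<^esub>}"
      using x by (simp add: S_def supp_verts_def)
    then have "linear_map K (rep_space V x) (rep_space I x) (\<lambda>_. \<zero>\<^bsub>B\<^esub>) \<and>
        bij_betw (\<lambda>_. \<zero>\<^bsub>B\<^esub>) (carrier (rep_space V x)) (carrier (rep_space I x))"
      using False zB I_space(1)[of x]
      by (auto intro!: linear_mapI representationD(1)[OF R x] simp: I_def bij_betw_def)
    then show ?thesis using False by blast
  qed
  then obtain f where
    lin: "\<And>x. x \<in> verts Q \<Longrightarrow> linear_map K (rep_space V x) (rep_space I x) (f x)"
    and bij: "\<And>x. x \<in> verts Q \<Longrightarrow> bij_betw (f x) (carrier (rep_space V x)) (carrier (rep_space I x))"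
    and f_e: "\<And>x. x \<in> S \<Longrightarrow> f x (e x) = e b"
    using bchoice[of "verts Q" "\<lambda>x g. linear_map K (rep_space V x) (rep_space I x) g \<and>
        bij_betw g (carrier (rep_space V x)) (carrier (rep_space I x)) \<and> (x \<in> S \<longrightarrow> g (e x) = e b)"]
    unfolding S_def supp_verts_def by blast
  have nat: "f (head Q a) (rep_map V a v) = rep_map I a (f (tail Q a) v)"
    if a: "a \<in> arcs Q" and v: "v \<in> carrier (rep_space V (tail Q a))" for a v
  proof -
    have t: "tail Q a \<in> verts Q" and h: "head Q a \<in> verts Q" using a by auto
    note A = linear_mapD[OF representationD(2)[OF R a]]
    show ?thesis
    proof (cases "tail Q a \<in> S \<and> head Q a \<in> S")
      case True
      note et = e[of "tail Q a"] and eh = e[of "head Q a"]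
      have "vectorspace.fin_dim K (rep_space V (tail Q a))"
        "vectorspace.dim K (rep_space V (tail Q a)) \<le> 1"
        using thin t by (auto simp: thin_def fin_dim_rep_def)
      then obtain c where c: "c \<in> carrier K" "v = c \<odot>\<^bsub>rep_space V (tail Q a)\<^esub> e (tail Q a)"
        using vectorspace.line_spanned[OF A(1) _ _ _ _ v] et True unfolding S_def by blast
      then have "rep_map V a v = c \<odot>\<^bsub>rep_space V (head Q a)\<^esub> e (head Q a)"
        using A(5) et True compat[OF a] by (simp add: S_def)
      then show ?thesis
        using c et eh True f_e linear_mapD(5)[OF lin[OF t] c(1)] linear_mapD(5)[OF lin[OF h] c(1)]
        by (simp add: I_def S_def)
    next
      case False
      have "f (head Q a) (rep_map V a v) = \<zero>\<^bsub>B\<^esub>"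
      proof (cases "head Q a \<in> S")
        case True
        then have "v = \<zero>\<^bsub>rep_space V (tail Q a)\<^esub>"
          using False v t by (auto simp: S_def supp_verts_def)
        then show ?thesis
          using A(6) linear_mapD(6)[OF lin[OF h]] True by (simp add: I_def)
      next
        case False
        then show ?thesis
          using linear_mapD(3)[OF lin[OF h] A(3)[OF v]] by (simp add: I_def)
      qed
      then show ?thesis using False by (auto simp: I_def)
    qed
  qed
  have iso: "rep_iso K Q V I"
    unfolding rep_iso_def using lin bij nat by blast
  have "interval_rep K Q I"
    unfolding interval_rep_def
  proof (intro conjI ballI)
    show "comm_representation K Q I"
      using wf V \<open>representation K Q I\<close> iso by (rule comm_representation_iso)
    show "thin K Q I"
      using I_space by (simp add: thin_def fin_dim_rep_def)
    show "interval Q (rep_supp Q I)"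
      using int supp_I by (simp add: rep_supp_conv S_def)
    fix a assume "a \<in> arcs (rep_supp Q I)"
    then have "tail Q a \<in> S" "head Q a \<in> S"
      unfolding rep_supp_conv supp_I by (auto simp: induce_subgraph_def)
    then show "rep_space I (tail Q a) = rep_space I (head Q a)" and "rep_map I a v = v" for v
      by (simp_all add: I_def)
  qed
  then show thesis using iso by (rule that)
qed

lemma zero_rep_interval_rep:
  assumes wf: "wf_digraph Q" and V: "comm_representation K Q V" and "thin K Q V"
    and empty: "supp_verts Q V = {}"
  shows "interval_rep K Q V" and "rep_iso K Q V V"
proof -
  interpret wf_digraph Q by (fact wf)
  have "induced_subgraph (rep_supp Q V) Q"
    unfolding rep_supp_conv empty by (rule induced_induce) simp
  then have "interval Q (rep_supp Q V)"
    by (simp add: interval_def rep_supp_conv empty)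
  moreover have "arcs (rep_supp Q V) = {}"
    by (simp add: rep_supp_conv empty induce_subgraph_def)
  ultimately show "interval_rep K Q V"
    using assms by (simp add: interval_rep_def)
  have "linear_map K (rep_space V x) (rep_space V x) (\<lambda>v. v)" if "x \<in> verts Q" for x
    using representationD(1)[OF comm_representationD(1)[OF V] that] by (intro linear_mapI) auto
  then show "rep_iso K Q V V"
    unfolding rep_iso_def by (intro exI[of _ "\<lambda>_ v. v"]) (auto simp: bij_betw_def)
qed

section \<open>Structure maps on the grid\<close>

definition below :: "nat \<times> nat \<Rightarrow> nat \<times> nat \<Rightarrow> bool" (infix \<open>\<preceq>\<close> 50) where
  "x \<preceq> y \<longleftrightarrow> fst x \<le> fst y \<and> snd x \<le> snd y"

lemma below_refl: "x \<preceq> x"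
  and below_trans: "x \<preceq> y \<Longrightarrow> y \<preceq> z \<Longrightarrow> x \<preceq> z"
  by (auto simp: below_def)

lemma grid_arc:
  assumes "a \<in> arcs (grid m n)"
  shows "a = (tail (grid m n) a, head (grid m n) a)"
    and "head (grid m n) a = (Suc (fst (tail (grid m n) a)), snd (tail (grid m n) a)) \<or>
         head (grid m n) a = (fst (tail (grid m n) a), Suc (snd (tail (grid m n) a)))"
  using assms by (auto simp: grid_def)

locale grid_representation =
  fixes K :: "('k, 'r) ring_scheme" and m n :: nat
    and M :: "(nat \<times> nat, (nat \<times> nat) \<times> (nat \<times> nat), 'k, 'v) quiver_rep"
  assumes comm: "comm_representation K (grid m n) M"
begin

abbreviation "G \<equiv> grid m n"

sublocale G: wf_digraph G
  by (rule wf_digraph_grid)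

lemmas rep = comm_representationD(1)[OF comm]
lemmas space = representationD(1)[OF rep]
lemmas arc_map = linear_mapD[OF representationD(2)[OF rep]]

lemma awalk_below:
  assumes "G.awalk x p y"
  shows "x \<preceq> y" and "length p + fst x + snd x = fst y + snd y"
proof -
  have "x \<preceq> y \<and> length p + fst x + snd x = fst y + snd y"
    using assms
  proof (induction p arbitrary: x)
    case (Cons a p)
    then have a: "a \<in> arcs G" "tail G a = x" and
      "head G a \<preceq> y" "length p + fst (head G a) + snd (head G a) = fst y + snd y"
      by (auto simp: G.awalk_Cons_iff)
    then show ?case
      using grid_arc(2)[OF a(1)] by (auto simp: below_def)
  qed (auto simp: G.awalk_Nil_iff below_refl)
  then show "x \<preceq> y" and "length p + fst x + snd x = fst y + snd y" by auto
qed

lemma ex_awalk: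
  assumes "x \<in> verts G" "y \<in> verts G" "x \<preceq> y"
  shows "\<exists>p. G.awalk x p y"
  using assms
proof (induction "fst y + snd y - (fst x + snd x)" arbitrary: x rule: less_induct)
  case less
  show ?case
  proof (cases "x = y")
    case True
    then have "G.awalk x [] y" using less by (simp add: G.awalk_Nil_iff)
    then show ?thesis by blast
  next
    case False
    define z where
      "z = (if fst x < fst y then (Suc (fst x), snd x) else (fst x, Suc (snd x)))"
    have "snd x < snd y" if "\<not> fst x < fst y"
      using False less.prems that by (auto simp: below_def prod_eq_iff)
    then have z: "z \<preceq> y" "z \<in> verts G"
      using less.prems by (auto simp: below_def z_def grid_def)
    have "fst z + snd z = Suc (fst x + snd x)" "fst z + snd z \<le> fst y + snd y"
      using z(1) by (auto simp: z_def below_def)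
    then have "fst y + snd y - (fst z + snd z) < fst y + snd y - (fst x + snd x)"
      by linarith
    then obtain p where "G.awalk z p y"
      using less.hyps[OF _ z(2) less.prems(2) z(1)] by blast
    moreover have "(x, z) \<in> arcs G"
      using less.prems z by (auto simp: z_def grid_def)
    ultimately have "G.awalk x ((x, z) # p) y"
      using less.prems by (simp add: G.awalk_Cons_iff) (simp add: grid_def)
    then show ?thesis by blast
  qed
qed

text \<open>
  The commutativity relations speak only of paths of length at least \<open>2\<close>. Shorter parallel paths in
  the grid are equal, since parallel paths have the same length and there are no double arrows.
\<close>
lemma fold_path_unique:
  assumes p: "G.awalk x p y" and q: "G.awalk x q y" and v: "v \<in> carrier (rep_space M x)"
  shows "fold (rep_map M) p v = fold (rep_map M) q v"
proof (cases "2 \<le> length p")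
  case True
  then show ?thesis
    using awalk_below(2)[OF p] awalk_below(2)[OF q] comm_representationD(2)[OF comm p q _ _ v] by simp
next
  case False
  have len: "length q = length p"
    using awalk_below(2)[OF p] awalk_below(2)[OF q] by simp
  have "p = q"
  proof (cases p)
    case Nil
    then show ?thesis using len by simp
  next
    case (Cons a p')
    then have "p = [a]" using False by (cases p') auto
    moreover from this obtain c where "q = [c]" using len by (auto simp: length_Suc_conv)
    ultimately show ?thesis
      using p q grid_arc(1)[of a m n] grid_arc(1)[of c m n]
      by (auto simp: G.awalk_Cons_iff G.awalk_Nil_iff)
  qed
  then show ?thesis by simp
qed

text \<open>
  The structure map \<open>M(x) \<rightarrow> M(y)\<close> for \<open>x \<preceq> y\<close>. Any path computes it (\<open>path_map_eq\<close>), so the choice is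
  immaterial.
\<close>
definition path_map :: "nat \<times> nat \<Rightarrow> nat \<times> nat \<Rightarrow> 'v \<Rightarrow> 'v" where
  "path_map x y = fold (rep_map M) (SOME p. G.awalk x p y)"

lemma path_map_eq:
  assumes "G.awalk x p y" and "v \<in> carrier (rep_space M x)"
  shows "path_map x y v = fold (rep_map M) p v"
  unfolding path_map_def using fold_path_unique[OF someI[of "\<lambda>p. G.awalk x p y"]] assms by blast

lemma path_map_refl:
  assumes "x \<in> verts G" and "v \<in> carrier (rep_space M x)"
  shows "path_map x x v = v"
  using path_map_eq[of x "[]" x v] assms by (simp add: G.awalk_Nil_iff)

lemma path_map_arc:
  assumes "a \<in> arcs G" and "v \<in> carrier (rep_space M (tail G a))"
  shows "path_map (tail G a) (head G a) v = rep_map M a v"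
  using path_map_eq[of "tail G a" "[a]" "head G a" v] assms by (simp add: G.arc_implies_awalk)

lemma path_map_closed:
  assumes "x \<in> verts G" "y \<in> verts G" "x \<preceq> y" and "v \<in> carrier (rep_space M x)"
  shows "path_map x y v \<in> carrier (rep_space M y)"
  using ex_awalk[OF assms(1-3)] path_map_eq[OF _ assms(4)] fold_path_closed[OF wf_digraph_grid rep _ assms(4)]
  by metis

lemma path_map_smult:
  assumes "x \<in> verts G" "y \<in> verts G" "x \<preceq> y" and "v \<in> carrier (rep_space M x)" and "c \<in> carrier K"
  shows "path_map x y (c \<odot>\<^bsub>rep_space M x\<^esub> v) = c \<odot>\<^bsub>rep_space M y\<^esub> path_map x y v"
proof -
  interpret vectorspace K "rep_space M x" using space assms(1) .
  obtain p where p: "G.awalk x p y"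
    using ex_awalk[OF assms(1-3)] by blast
  show ?thesis
    using fold_path_smult[OF wf_digraph_grid rep p assms(4,5)] path_map_eq[OF p] assms(4,5) by simp
qed

lemma path_map_comp:
  assumes "x \<in> verts G" "y \<in> verts G" "z \<in> verts G" "x \<preceq> y" "y \<preceq> z"
    and v: "v \<in> carrier (rep_space M x)"
  shows "path_map y z (path_map x y v) = path_map x z v"
proof -
  obtain p q where p: "G.awalk x p y" and q: "G.awalk y q z"
    using ex_awalk assms by metis
  have "path_map x z v = fold (rep_map M) (p @ q) v"
    using p q v by (intro path_map_eq) (simp add: G.awalk_appendI)
  also have "\<dots> = path_map y z (path_map x y v)"
    using path_map_eq[OF p v] path_map_eq[OF q] fold_path_closed[OF wf_digraph_grid rep p v] by simp
  finally show ?thesis by simp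
qed

end

section \<open>Coherence of transport\<close>

text \<open>A discrete intermediate value theorem, for a coordinate along a zigzag.\<close>
lemma crossing:
  fixes h :: "nat \<Rightarrow> nat"
  assumes "h 1 = Suc c" and "Suc (h (k - 1)) = c" and "2 \<le> k"
    and step: "\<And>i. i < k \<Longrightarrow> h (Suc i) \<le> Suc (h i) \<and> h i \<le> Suc (h (Suc i))"
  obtains i where "0 < i" "i < k" "h i = c"
proof -
  have "\<exists>i. 0 < i \<and> i < k \<and> h i = c"
  proof (rule ccontr)
    assume neg: "\<not> ?thesis"
    have "c < h (Suc i)" if "Suc i < k" for i
      using that
    proof (induction i)
      case (Suc i)
      then have "c < h (Suc i)" "h (Suc (Suc i)) \<noteq> c" using neg by auto
      then show ?case using step[of "Suc i"] Suc.prems by linarith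
    qed (use assms(1) in simp)
    from this[of "k - 2"] show False
      using assms(2,3) by (simp add: Suc_diff_Suc numeral_2_eq_2)
  qed
  then show thesis using that by blast
qed

text \<open>
  The two ends of a zigzag from \<open>(x, x')\<close> up to \<open>(y, y')\<close> that starts with a step up to \<open>(a, a')\<close>, ends
  with a step up from \<open>(c, c')\<close>, and has no inner vertex comparable to both end points. To step out of
  the box spanned by the end points at once, it must start and end in a direction in which the box is
  degenerate; so it starts and ends on opposite sides of a line through both end points.
\<close>
lemma opposite_sides:
  fixes a a' c c' x x' y y' :: nat
  assumes "x \<le> y" "x' \<le> y'"
    and "a = Suc x \<and> a' = x' \<or> a = x \<and> a' = Suc x'"
    and "y = Suc c \<and> y' = c' \<or> y = c \<and> y' = Suc c'"
    and "\<not> (y \<le> a \<and> y' \<le> a')"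
    and "\<not> (x \<le> a \<and> x' \<le> a' \<and> a \<le> y \<and> a' \<le> y')"
    and "\<not> (x \<le> c \<and> x' \<le> c' \<and> c \<le> y \<and> c' \<le> y')"
  shows "x = y \<and> a = Suc x \<and> Suc c = x \<or> x' = y' \<and> a' = Suc x' \<and> Suc c' = x'"
  using assms by presburger

locale thin_grid_representation = grid_representation K m n M
  for K :: "('k, 'r) ring_scheme" and m n :: nat
    and M :: "(nat \<times> nat, (nat \<times> nat) \<times> (nat \<times> nat), 'k, 'v) quiver_rep" +
  assumes thin: "thin K (grid m n) M"
begin

text \<open>Zigzags run through pairs of a vertex and a nonzero vector of the line at that vertex.\<close>
definition nonzero_at :: "(nat \<times> nat) \<times> 'v \<Rightarrow> bool" where
  "nonzero_at s \<longleftrightarrow> fst s \<in> verts G \<and> snd s \<in> carrier (rep_space M (fst s)) \<and>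
    snd s \<noteq> \<zero>\<^bsub>rep_space M (fst s)\<^esub>"

definition transports :: "(nat \<times> nat) \<times> 'v \<Rightarrow> (nat \<times> nat) \<times> 'v \<Rightarrow> bool" where
  "transports s t \<longleftrightarrow> nonzero_at s \<and> nonzero_at t \<and>
    (\<exists>a \<in> arcs G. tail G a = fst s \<and> head G a = fst t \<and> rep_map M a (snd s) = snd t)"

definition linked :: "(nat \<times> nat) \<times> 'v \<Rightarrow> (nat \<times> nat) \<times> 'v \<Rightarrow> bool" where
  "linked s t \<longleftrightarrow> transports s t \<or> transports t s"

lemma linked_sym: "linked s t \<Longrightarrow> linked t s"
  by (auto simp: linked_def)

lemma linked_nonzero: "linked s t \<Longrightarrow> nonzero_at s \<and> nonzero_at t"
  by (auto simp: linked_def transports_def)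

lemma transports_step:
  assumes "transports s t"
  shows "fst t = (Suc (fst (fst s)), snd (fst s)) \<or> fst t = (fst (fst s), Suc (snd (fst s)))"
    and "path_map (fst s) (fst t) (snd s) = snd t"
proof -
  obtain a where a: "a \<in> arcs G" "tail G a = fst s" "head G a = fst t" "rep_map M a (snd s) = snd t"
    and s: "nonzero_at s"
    using assms by (auto simp: transports_def)
  show "fst t = (Suc (fst (fst s)), snd (fst s)) \<or> fst t = (fst (fst s), Suc (snd (fst s)))"
    using grid_arc(2)[OF a(1)] a by simp
  show "path_map (fst s) (fst t) (snd s) = snd t"
    using path_map_arc[OF a(1), of "snd s"] a s by (simp add: nonzero_at_def)
qed

lemma linked_step:
  assumes "linked s t"
  shows "fst t = (Suc (fst (fst s)), snd (fst s)) \<or> fst t = (fst (fst s), Suc (snd (fst s))) \<or>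
         fst s = (Suc (fst (fst t)), snd (fst t)) \<or> fst s = (fst (fst t), Suc (snd (fst t)))"
  using assms transports_step(1) unfolding linked_def by blast

text \<open>A linear map from a line is injective once it does not kill everything.\<close>
lemma path_map_cancel:
  assumes "x \<in> verts G" "y \<in> verts G" "x \<preceq> y"
    and v: "v \<in> carrier (rep_space M x)" and w: "w \<in> carrier (rep_space M x)"
    and eq: "path_map x y v = path_map x y w"
    and nz: "path_map x y w \<noteq> \<zero>\<^bsub>rep_space M y\<^esub>"
  shows "v = w"
proof -
  interpret X: vectorspace K "rep_space M x" using space assms(1) .
  interpret Y: vectorspace K "rep_space M y" using space assms(2) .
  have closed: "path_map x y w \<in> carrier (rep_space M y)"
    using path_map_closed assms by blast
  have "w \<noteq> \<zero>\<^bsub>rep_space M x\<^esub>"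
  proof
    assume "w = \<zero>\<^bsub>rep_space M x\<^esub>"
    then have "path_map x y w = path_map x y (\<zero>\<^bsub>K\<^esub> \<odot>\<^bsub>rep_space M x\<^esub> w)"
      using w by simp
    also have "\<dots> = \<zero>\<^bsub>rep_space M y\<^esub>"
      using path_map_smult[OF assms(1-3) w, of "\<zero>\<^bsub>K\<^esub>"] closed by simp
    finally show False using nz by simp
  qed
  moreover have "X.fin_dim" "X.dim \<le> 1"
    using thin assms(1) by (auto simp: thin_def fin_dim_rep_def)
  ultimately obtain c where c: "c \<in> carrier K" "v = c \<odot>\<^bsub>rep_space M x\<^esub> w"
    using X.line_spanned[OF _ _ w _ v] by blast
  then have "c \<odot>\<^bsub>rep_space M y\<^esub> path_map x y w = \<one>\<^bsub>K\<^esub> \<odot>\<^bsub>rep_space M y\<^esub> path_map x y w"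
    using path_map_smult[OF assms(1-3) w] eq closed by simp
  then have "c = \<one>\<^bsub>K\<^esub>"
    using Y.scale_inject[OF c(1) _ closed nz] by simp
  then show ?thesis using c w by simp
qed

text \<open>
  A shortest counterexample cannot be cut at an inner vertex comparable to both ends, and a zigzag
  without such a vertex would start and end on opposite sides of a grid line through both ends
  without ever meeting that line in between. Since \<open>p k\<close> carries a nonzero vector, the conclusion also
  says that the structure map is nonzero.
\<close>
lemma chain_coherent:
  assumes "\<And>i. i < k \<Longrightarrow> linked (p i) (p (Suc i))" and "nonzero_at (p 0)"
    and "fst (p 0) \<preceq> fst (p k)"
  shows "path_map (fst (p 0)) (fst (p k)) (snd (p 0)) = snd (p k)"
  using assms
proof (induction k arbitrary: p rule: less_induct)
  case (less k)
  have nz: "nonzero_at (p i)" if "i \<le> k" for i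
    using that less.prems(2) linked_nonzero[OF less.prems(1)[of "i - 1"]] by (cases i) auto
  note nz' = nz[unfolded nonzero_at_def]
  \<comment> \<open>The induction hypothesis applies to every proper segment of the zigzag, read either way.\<close>
  have fwd: "path_map (fst (p i)) (fst (p j)) (snd (p i)) = snd (p j)"
    if "i \<le> j" "j \<le> k" "j - i < k" "fst (p i) \<preceq> fst (p j)" for i j
    using less.IH[of "j - i" "\<lambda>l. p (i + l)"] less.prems(1) that nz[of i] by simp
  have bwd: "path_map (fst (p j)) (fst (p i)) (snd (p j)) = snd (p i)"
    if "i \<le> j" "j \<le> k" "j - i < k" "fst (p j) \<preceq> fst (p i)" for i j
  proof -
    have "linked (p (j - l)) (p (j - Suc l))" if "l < j - i" for l
      using less.prems(1)[of "j - Suc l"] that \<open>j \<le> k\<close> linked_sym by (simp add: Suc_diff_Suc)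
    then show ?thesis
      using less.IH[of "j - i" "\<lambda>l. p (j - l)"] that nz[of j] by simp
  qed
  define x y v w where "x = fst (p 0)" and "y = fst (p k)" and "v = snd (p 0)" and "w = snd (p k)"
  have x: "x \<in> verts G" "v \<in> carrier (rep_space M x)"
    and y: "y \<in> verts G" "w \<in> carrier (rep_space M y)"
    using nz'[of 0] nz'[of k] by (auto simp: x_def y_def v_def w_def)
  have xy: "x \<preceq> y" using less.prems(3) by (simp add: x_def y_def)
  \<comment> \<open>The zigzag can be cut at an inner vertex comparable to both ends.\<close>
  have inner: "path_map x y v = w"
    if i: "0 < i" "i < k" and
      cmp: "fst (p i) \<preceq> x \<or> y \<preceq> fst (p i) \<or> x \<preceq> fst (p i) \<and> fst (p i) \<preceq> y" for i
  proof -
    define z u where "z = fst (p i)" and "u = snd (p i)"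
    have z: "z \<in> verts G" "u \<in> carrier (rep_space M z)" "u \<noteq> \<zero>\<^bsub>rep_space M z\<^esub>"
      using nz'[of i] i by (auto simp: z_def u_def)
    have F0: "x \<preceq> z \<Longrightarrow> path_map x z v = u" and F1: "z \<preceq> y \<Longrightarrow> path_map z y u = w"
      and B0: "z \<preceq> x \<Longrightarrow> path_map z x u = v" and B1: "y \<preceq> z \<Longrightarrow> path_map y z w = u"
      using fwd[of 0 i] fwd[of i k] bwd[of 0 i] bwd[of i k] i
      by (simp_all add: x_def y_def v_def w_def z_def u_def)
    consider "z \<preceq> x" | "y \<preceq> z" | "x \<preceq> z" "z \<preceq> y" using cmp by (auto simp: z_def)
    then show ?thesis
    proof cases
      case 1
      then show ?thesis
        using B0 F1 path_map_comp[OF z(1) x(1) y(1) _ xy z(2)] below_trans xy by auto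
    next
      case 2
      \<comment> \<open>Only the images in the space at \<open>z\<close> are known to agree, so the map from \<open>y\<close> is cancelled.\<close>
      then have "path_map y z (path_map x y v) = path_map y z w"
        using F0 B1 path_map_comp[OF x(1) y(1) z(1) xy _ x(2)] below_trans[OF xy] by auto
      then show ?thesis
        using path_map_cancel[OF y(1) z(1) 2 path_map_closed[OF x(1) y(1) xy x(2)] y(2)] B1[OF 2] z(3)
        by simp
    next
      case 3
      then show ?thesis
        using F0 F1 path_map_comp[OF x(1) z(1) y(1) _ _ x(2)] by auto
    qed
  qed
  have "path_map x y v = w"
  proof (cases "k \<le> 1")
    case True
    then consider "k = 0" | "k = 1" by linarith
    then show ?thesis
    proof cases
      case 1
      then show ?thesis using x by (simp add: x_def y_def v_def w_def path_map_refl)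
    next
      case 2
      then have l: "linked (p 0) (p k)" using less.prems(1)[of 0] by simp
      have "\<not> transports (p k) (p 0)"
        using transports_step(1)[of "p k" "p 0"] less.prems(3) by (auto simp: below_def)
      then have "transports (p 0) (p k)" using l by (simp add: linked_def)
      then show ?thesis
        using transports_step(2) by (simp add: x_def y_def v_def w_def)
    qed
  next
    case False
    show ?thesis
    proof (rule ccontr)
      assume ne: "path_map x y v \<noteq> w"
      have out: "\<not> fst (p i) \<preceq> x" "\<not> y \<preceq> fst (p i)" "\<not> (x \<preceq> fst (p i) \<and> fst (p i) \<preceq> y)"
        if "0 < i" "i < k" for i
        using inner[OF that] ne by auto
      note o1 = out[of 1] and ok = out[of "k - 1"]
      have l1: "linked (p 0) (p 1)" and lk: "linked (p (k - 1)) (p k)"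
        using less.prems(1)[of 0] less.prems(1)[of "k - 1"] False by simp_all
      have steps: "fst (fst (p (Suc i))) \<le> Suc (fst (fst (p i)))"
        "fst (fst (p i)) \<le> Suc (fst (fst (p (Suc i))))"
        "snd (fst (p (Suc i))) \<le> Suc (snd (fst (p i)))"
        "snd (fst (p i)) \<le> Suc (snd (fst (p (Suc i))))" if "i < k" for i
        using linked_step[OF less.prems(1)[OF that]] by auto
      \<comment> \<open>A step down from \<open>x\<close>, or a step down to \<open>y\<close>, would give a comparable inner vertex.\<close>
      have first: "fst (p 1) = (Suc (fst x), snd x) \<or> fst (p 1) = (fst x, Suc (snd x))"
        using linked_step[OF l1] o1(1) False by (auto simp: x_def below_def)
      have last: "y = (Suc (fst (fst (p (k - 1)))), snd (fst (p (k - 1)))) \<or>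
                  y = (fst (fst (p (k - 1))), Suc (snd (fst (p (k - 1)))))"
        using linked_step[OF lk] ok(2) False by (auto simp: y_def below_def)
      have "fst x = fst y \<and> fst (fst (p 1)) = Suc (fst x) \<and> Suc (fst (fst (p (k - 1)))) = fst x \<or>
            snd x = snd y \<and> snd (fst (p 1)) = Suc (snd x) \<and> Suc (snd (fst (p (k - 1)))) = snd x"
      proof (rule opposite_sides)
        show "fst (fst (p 1)) = Suc (fst x) \<and> snd (fst (p 1)) = snd x \<or>
              fst (fst (p 1)) = fst x \<and> snd (fst (p 1)) = Suc (snd x)"
          using first by auto
        show "fst y = Suc (fst (fst (p (k - 1)))) \<and> snd y = snd (fst (p (k - 1))) \<or>
              fst y = fst (fst (p (k - 1))) \<and> snd y = Suc (snd (fst (p (k - 1))))"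
          using last by (metis fst_conv snd_conv)
      qed (use o1(2,3) ok(3) xy False in \<open>auto simp: below_def\<close>)
      then show False
      proof
        assume *: "fst x = fst y \<and> fst (fst (p 1)) = Suc (fst x) \<and> Suc (fst (fst (p (k - 1)))) = fst x"
        then obtain i where "0 < i" "i < k" "fst (fst (p i)) = fst x"
          using crossing[of "\<lambda>i. fst (fst (p i))" "fst x" k] steps False by auto
        then show False using out[of i] * by (auto simp: below_def)
      next
        assume *: "snd x = snd y \<and> snd (fst (p 1)) = Suc (snd x) \<and> Suc (snd (fst (p (k - 1)))) = snd x"
        then obtain i where "0 < i" "i < k" "snd (fst (p i)) = snd x"
          using crossing[of "\<lambda>i. snd (fst (p i))" "snd x" k] steps False by auto
        then show False using out[of i] * by (auto simp: below_def)
      qed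
    qed
  qed
  then show ?case by (simp add: x_def y_def v_def w_def)
qed

lemma linked_coherent:
  assumes "linked\<^sup>*\<^sup>* s t" and "nonzero_at s" and "fst s \<preceq> fst t"
  shows "path_map (fst s) (fst t) (snd s) = snd t"
proof -
  obtain k where "(linked ^^ k) s t"
    using assms(1) by (auto simp: rtranclp_is_Sup_relpowp)
  then obtain p where "p 0 = s" "p k = t" "\<forall>i<k. linked (p i) (p (Suc i))"
    by (auto simp: relpowp_fun_conv)
  then show ?thesis
    using chain_coherent[of k p] assms by auto
qed

lemma linked_rtrancl_sym: "linked\<^sup>*\<^sup>* s t \<Longrightarrow> linked\<^sup>*\<^sup>* t s"
  by (induction rule: rtranclp_induct) (auto intro: converse_rtranclp_into_rtranclp linked_sym)

lemma linked_rtrancl_nonzero: "linked\<^sup>*\<^sup>* s t \<Longrightarrow> nonzero_at s \<Longrightarrow> nonzero_at t"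
  by (induction rule: rtranclp_induct) (auto dest: linked_nonzero)

section \<open>The class of a nonzero vector\<close>

context
  fixes s assumes s: "nonzero_at s"
begin

text \<open>
  The vertices met by the zigzags from \<open>s\<close>. By coherence these zigzags arrive with only one vector at
  each such vertex, so \<open>basis_vec\<close> below is really determined by the class.
\<close>
definition reached :: "(nat \<times> nat) set" where
  "reached = {x. \<exists>v. linked\<^sup>*\<^sup>* s (x, v)}"

definition basis_vec :: "nat \<times> nat \<Rightarrow> 'v" where
  "basis_vec x = (SOME v. linked\<^sup>*\<^sup>* s (x, v))"

lemma reached_linked: "x \<in> reached \<Longrightarrow> linked\<^sup>*\<^sup>* s (x, basis_vec x)"
  unfolding reached_def basis_vec_def by (auto intro: someI)

lemma reached_nonzero: "x \<in> reached \<Longrightarrow> nonzero_at (x, basis_vec x)"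
  using reached_linked linked_rtrancl_nonzero s by blast

lemma basis_vec_coherent:
  assumes "x \<in> reached" and "linked\<^sup>*\<^sup>* s (y, w)" and "x \<preceq> y"
  shows "path_map x y (basis_vec x) = w"
  using linked_coherent[of "(x, basis_vec x)" "(y, w)"] reached_nonzero[OF assms(1)] assms(2,3)
    rtranclp_trans[OF linked_rtrancl_sym[OF reached_linked[OF assms(1)]] assms(2)] by simp

lemma reached_supp: "reached \<subseteq> supp_verts G M"
  using reached_nonzero by (force simp: nonzero_at_def supp_verts_def)

text \<open>
  A nonzero map between lines is an isomorphism, so the class of \<open>s\<close> spreads along it in both
  directions. Hence the arrows between reached and other vertices vanish.
\<close>
lemma no_arc_leaves_reached:
  assumes a: "a \<in> arcs G" and cut: "(tail G a \<in> reached) \<noteq> (head G a \<in> reached)"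
    and v: "v \<in> carrier (rep_space M (tail G a))"
  shows "rep_map M a v = \<zero>\<^bsub>rep_space M (head G a)\<^esub>"
proof (rule ccontr)
  assume nz: "rep_map M a v \<noteq> \<zero>\<^bsub>rep_space M (head G a)\<^esub>"
  let ?x = "tail G a" and ?y = "head G a"
  have x: "?x \<in> verts G" and y: "?y \<in> verts G" using a by auto
  note A = arc_map[OF a]
  have "v \<noteq> \<zero>\<^bsub>rep_space M ?x\<^esub>" using A(6) nz by auto
  have tr: "transports (?x, u) (?y, rep_map M a u)"
    if "u \<in> carrier (rep_space M ?x)" "rep_map M a u \<noteq> \<zero>\<^bsub>rep_space M ?y\<^esub>" for u
    using that a x y A(3)[OF that(1)] A(6) by (auto simp: transports_def nonzero_at_def)
  interpret X: vectorspace K "rep_space M ?x" using space[OF x] .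
  interpret Y: vectorspace K "rep_space M ?y" using space[OF y] .
  have Xd: "X.fin_dim" "X.dim \<le> 1" and Yd: "Y.fin_dim" "Y.dim \<le> 1"
    using thin x y by (auto simp: thin_def fin_dim_rep_def)
  consider "?x \<in> reached" "?y \<notin> reached" | "?y \<in> reached" "?x \<notin> reached" using cut by auto
  then show False
  proof cases
    case 1
    let ?e = "basis_vec ?x"
    have e: "?e \<in> carrier (rep_space M ?x)" "?e \<noteq> \<zero>\<^bsub>rep_space M ?x\<^esub>"
      using reached_nonzero[OF 1(1)] by (auto simp: nonzero_at_def)
    obtain c where c: "c \<in> carrier K" "v = c \<odot>\<^bsub>rep_space M ?x\<^esub> ?e"
      using X.line_spanned[OF Xd e v] by blast
    then have "rep_map M a ?e \<noteq> \<zero>\<^bsub>rep_space M ?y\<^esub>"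
      using A(5)[OF c(1) e(1)] nz by auto
    then have "linked\<^sup>*\<^sup>* s (?y, rep_map M a ?e)"
      using rtranclp.rtrancl_into_rtrancl[OF reached_linked[OF 1(1)]] tr[OF e(1)] by (simp add: linked_def)
    then show False using 1 by (auto simp: reached_def)
  next
    case 2
    let ?e = "basis_vec ?y"
    have e: "?e \<in> carrier (rep_space M ?y)" "?e \<noteq> \<zero>\<^bsub>rep_space M ?y\<^esub>"
      using reached_nonzero[OF 2(1)] by (auto simp: nonzero_at_def)
    obtain c where c: "c \<in> carrier K" "?e = c \<odot>\<^bsub>rep_space M ?y\<^esub> rep_map M a v"
      using Y.line_spanned[OF Yd A(3)[OF v] nz e(1)] by blast
    then have u: "rep_map M a (c \<odot>\<^bsub>rep_space M ?x\<^esub> v) = ?e"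
      using A(5)[OF c(1) v] by simp
    then have "transports (?x, c \<odot>\<^bsub>rep_space M ?x\<^esub> v) (?y, ?e)"
      using tr[of "c \<odot>\<^bsub>rep_space M ?x\<^esub> v"] e c v by simp
    then have "linked\<^sup>*\<^sup>* s (?x, c \<odot>\<^bsub>rep_space M ?x\<^esub> v)"
      using rtranclp.rtrancl_into_rtrancl[OF reached_linked[OF 2(1)]] by (simp add: linked_def)
    then show False using 2 by (auto simp: reached_def)
  qed
qed

lemma reached_eq_supp:
  assumes "indecomposable K G M"
  shows "reached = supp_verts G M"
proof -
  have "fst s \<in> reached"
    unfolding reached_def by (auto intro: exI[of _ "snd s"])
  then have "\<not> (\<forall>x \<in> verts G \<inter> reached. carrier (rep_space M x) = {\<zero>\<^bsub>rep_space M x\<^esub>})"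
    using reached_supp by (auto simp: supp_verts_def)
  then have "\<forall>x \<in> verts G - reached. carrier (rep_space M x) = {\<zero>\<^bsub>rep_space M x\<^esub>}"
    using indecomposable_no_split[OF wf_digraph_grid comm assms no_arc_leaves_reached] by blast
  then show ?thesis
    using reached_supp by (auto simp: supp_verts_def)
qed

text \<open>
  The structure map from \<open>x\<close> to \<open>y\<close> sends basis vector to basis vector and factors through the space
  at \<open>z\<close>, which is therefore not zero.
\<close>
lemma reached_convex:
  assumes x: "x \<in> reached" and y: "y \<in> reached" and z: "z \<in> verts G" and xz: "x \<preceq> z" and zy: "z \<preceq> y"
  shows "z \<in> supp_verts G M"
proof -
  let ?u = "path_map x z (basis_vec x)"
  have ex: "x \<in> verts G" "basis_vec x \<in> carrier (rep_space M x)"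
    and ey: "y \<in> verts G" "basis_vec y \<noteq> \<zero>\<^bsub>rep_space M y\<^esub>"
    using reached_nonzero[OF x] reached_nonzero[OF y] by (auto simp: nonzero_at_def)
  have u: "?u \<in> carrier (rep_space M z)"
    using path_map_closed ex z xz by blast
  have "path_map z y ?u = basis_vec y"
    using path_map_comp[OF ex(1) z ey(1) xz zy ex(2)] basis_vec_coherent[OF x reached_linked[OF y]]
      below_trans[OF xz zy] by simp
  moreover have "path_map z y \<zero>\<^bsub>rep_space M z\<^esub> = \<zero>\<^bsub>rep_space M y\<^esub>"
  proof -
    interpret Z: vectorspace K "rep_space M z" using space[OF z] .
    interpret Y: vectorspace K "rep_space M y" using space[OF ey(1)] .
    show ?thesis
      using path_map_smult[OF z ey(1) zy, of "\<zero>\<^bsub>rep_space M z\<^esub>" "\<zero>\<^bsub>K\<^esub>"]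
        path_map_closed[OF z ey(1) zy, of "\<zero>\<^bsub>rep_space M z\<^esub>"] by simp
  qed
  ultimately have "?u \<noteq> \<zero>\<^bsub>rep_space M z\<^esub>"
    using ey(2) by auto
  then show ?thesis
    using u z by (auto simp: supp_verts_def)
qed

lemma interval_supp:
  assumes "reached = supp_verts G M"
  shows "interval G (rep_supp G M)"
proof -
  let ?S = "supp_verts G M"
  have sub: "?S \<subseteq> verts G" by (auto simp: supp_verts_def)
  have verts: "verts (rep_supp G M) = ?S"
    by (simp add: rep_supp_conv)
  have "induced_subgraph (rep_supp G M) G"
    unfolding rep_supp_conv using sub by (rule G.induced_induce)
  moreover have "set (G.awalk_verts x p) \<subseteq> ?S"
    if x: "x \<in> ?S" and y: "y \<in> ?S" and p: "G.awalk x p y" for x y p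
  proof
    fix z assume "z \<in> set (G.awalk_verts x p)"
    then obtain q r where "G.awalk x q z" "G.awalk z r y"
      using G.awalk_decomp[OF p] by blast
    then show "z \<in> ?S"
      using reached_convex[of x y z] awalk_below(1) x y assms by (auto dest: G.awalk_last_in_verts)
  qed
  moreover have "Digraph_Component.connected (rep_supp G M)"
  proof -
    let ?H = "mk_symmetric (rep_supp G M)"
    have arc: "(fst t, fst u) \<in> parcs ?H"
      if link: "linked t u" and "fst t \<in> ?S" "fst u \<in> ?S" for t u
    proof -
      obtain a where a: "a \<in> arcs G" and
        ends: "tail G a = fst t \<and> head G a = fst u \<or> tail G a = fst u \<and> head G a = fst t"
        using link unfolding linked_def transports_def by blast
      then have "a \<in> arcs (rep_supp G M)"
        using that by (auto simp: rep_supp_conv induce_subgraph_def)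
      moreover have "tail (rep_supp G M) = tail G" "head (rep_supp G M) = head G"
        by (simp_all add: rep_supp_conv)
      ultimately show ?thesis
        using ends unfolding mk_symmetric_def by (auto intro!: bexI[of _ a])
    qed
    have V: "verts (with_proj ?H) = ?S"
      by (simp add: mk_symmetric_def verts)
    have reach: "fst u \<in> ?S \<and> fst t \<rightarrow>\<^sup>*\<^bsub>with_proj ?H\<^esub> fst u"
      if "linked\<^sup>*\<^sup>* t u" "fst t \<in> reached" "nonzero_at t" for t u
      using that
    proof (induction rule: rtranclp_induct)
      case base
      then show ?case using assms V by (simp add: reachable_def)
    next
      case (step u u')
      then have "fst u' \<in> ?S"
        using linked_nonzero[of u u'] by (auto simp: nonzero_at_def supp_verts_def)
      moreover have "(fst u, fst u') \<in> arcs_ends (with_proj ?H)"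
        using arc[of u u'] step calculation by (auto simp: arcs_ends_def arc_to_ends_def)
      ultimately show ?case
        using step V unfolding reachable_def by (auto intro: rtrancl_on_into_rtrancl_on)
    qed
    show ?thesis
      unfolding Digraph_Component.connected_def
    proof (rule strongly_connectedI)
      have "fst s \<in> reached"
        unfolding reached_def by (auto intro: exI[of _ "snd s"])
      then show "verts (with_proj ?H) \<noteq> {}"
        using assms V by auto
      fix x y assume "x \<in> verts (with_proj ?H)" "y \<in> verts (with_proj ?H)"
      then have x: "x \<in> reached" and y: "y \<in> reached"
        using assms V by auto
      have "linked\<^sup>*\<^sup>* (x, basis_vec x) (y, basis_vec y)"
        using linked_rtrancl_sym[OF reached_linked[OF x]] reached_linked[OF y] by (rule rtranclp_trans)
      then show "x \<rightarrow>\<^sup>*\<^bsub>with_proj ?H\<^esub> y"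
        using reach[of "(x, basis_vec x)" "(y, basis_vec y)"] x reached_nonzero[OF x] by simp
    qed
  qed
  ultimately show ?thesis
    unfolding interval_def verts by blast
qed

lemma basis_vec_arc:
  assumes a: "a \<in> arcs G" and x: "tail G a \<in> reached" and y: "head G a \<in> reached"
  shows "rep_map M a (basis_vec (tail G a)) = basis_vec (head G a)"
proof -
  have "tail G a \<preceq> head G a"
    using grid_arc(2)[OF a] by (auto simp: below_def)
  then show ?thesis
    using basis_vec_coherent[OF x reached_linked[OF y]] path_map_arc[OF a] reached_nonzero[OF x]
    by (simp add: nonzero_at_def)
qed

end

end

section \<open>Thin indecomposables are interval representations\<close>

theorem theorem4p4:
  fixes K :: "('k, 'r) ring_scheme"
    and m n :: nat
    and M :: "(nat \<times> nat, (nat \<times> nat) \<times> (nat \<times> nat), 'k, 'v) quiver_rep"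
  assumes "field K"
    and "0 < m" and "0 < n"
    and "comm_representation K (grid m n) M"
    and "fin_dim_rep K (grid m n) M"
    and "thin K (grid m n) M"
    and "indecomposable K (grid m n) M"
  shows "\<exists>I :: (nat \<times> nat, (nat \<times> nat) \<times> (nat \<times> nat), 'k, 'v) quiver_rep.
           interval_rep K (grid m n) I \<and> rep_iso K (grid m n) M I"
proof (cases "supp_verts (grid m n) M = {}")
  case True
  then show ?thesis
    using zero_rep_interval_rep[OF wf_digraph_grid assms(4,6)] by blast
next
  case False
  interpret thin_grid_representation K m n M
    using assms by unfold_locales
  obtain b where b: "b \<in> supp_verts G M" using False by blast
  then have "\<zero>\<^bsub>rep_space M b\<^esub> \<in> carrier (rep_space M b)"
    using vectorspace_zero(1)[OF space] by (auto simp: supp_verts_def)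
  then obtain v where v: "nonzero_at (b, v)"
    using b by (auto simp: supp_verts_def nonzero_at_def)
  note S = reached_eq_supp[OF v assms(7)]
  show ?thesis
  proof (rule compatible_basis_imp_interval_rep[OF wf_digraph_grid assms(4,6) interval_supp[OF v S] _ _ b])
    fix x assume "x \<in> supp_verts G M"
    then show "basis_vec (b, v) x \<in> carrier (rep_space M x) \<and> basis_vec (b, v) x \<noteq> \<zero>\<^bsub>rep_space M x\<^esub>"
      using reached_nonzero[OF v, of x] S by (simp add: nonzero_at_def)
  next
    fix a assume "a \<in> arcs G" "tail G a \<in> supp_verts G M" "head G a \<in> supp_verts G M"
    then show "rep_map M a (basis_vec (b, v) (tail G a)) = basis_vec (b, v) (head G a)"
      using basis_vec_arc[OF v] S by simp
  qed blast
qed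

end
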